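(* There is an algorithm which, given a finite collection $F$ of nonsingular matrices from $\mathbb{Z}^{2\times 2}$ and a matrix $M\in\mathbb{Z}^{2\times 2}$, decides whether $M\in\langle F\rangle$.
   Context: A matrix is nonsingular if its determinant is nonzero. For a finite set $F\subseteq\mathbb{Z}^{2\times 2}$, $\langle F\rangle$ denotes the semigroup generated by $F$ including the identity matrix: $M\in\langle F\rangle$ iff $M=I$ or $M=M_1\cdots M_k$ for some $k\ge 1$ and $M_1,\dots,M_k\in F$. *)

theory Defs
  imports "HOL-Analysis.Determinants" "HOL-Library.Nat_Bijection"
begin

text \<open>
  Algorithms are terms for Kleene's partial recursive functions, with a big-step semantics:
  \<open>computes f xs y\<close> means that \<open>f\<close> halts on the arguments \<open>xs\<close> with the value \<open>y\<close>.
  Arities are not tracked by the syntax; a term applied to an argument list of an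
  unsuitable length may simply have no value.
\<close>

datatype recf =
    Zero
  | Succ
  | Proj nat
  | Comp recf "recf list"
  | PrimRec recf recf
  | Mu recf

inductive computes :: "recf \<Rightarrow> nat list \<Rightarrow> nat \<Rightarrow> bool" where
  zero: "computes Zero xs 0"
| succ: "computes Succ [x] (Suc x)"
| proj: "i < length xs \<Longrightarrow> computes (Proj i) xs (xs ! i)"
| comp: "list_all2 (\<lambda>g y. computes g xs y) gs ys \<Longrightarrow> computes f ys z
    \<Longrightarrow> computes (Comp f gs) xs z"
| rec_0: "computes f xs y \<Longrightarrow> computes (PrimRec f g) (0 # xs) y"
| rec_Suc: "computes (PrimRec f g) (n # xs) y \<Longrightarrow> computes g (n # y # xs) z
    \<Longrightarrow> computes (PrimRec f g) (Suc n # xs) z"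
| mu: "computes f (n # xs) 0 \<Longrightarrow> (\<And>m. m < n \<Longrightarrow> \<exists>y. computes f (m # xs) (Suc y))
    \<Longrightarrow> computes (Mu f) xs n"

lemma computes_deterministic:
  "computes f xs y \<Longrightarrow> computes f xs z \<Longrightarrow> y = z"
proof (induction arbitrary: z rule: computes.induct)
  case (zero xs)
  from zero.prems show ?case by (cases rule: computes.cases) simp_all
next
  case (succ x)
  from succ.prems show ?case by (cases rule: computes.cases) simp_all
next
  case (proj i xs)
  from proj.prems show ?case by (cases rule: computes.cases) simp_all
next
  case (comp xs gs ys f w)
  from comp.prems obtain ys' where ys': "list_all2 (\<lambda>g y. computes g xs y) gs ys'" "computes f ys' z"
    by (cases rule: computes.cases) simp_all
  have "ys = ys'"
    using comp.IH(1) ys'(1) by (auto simp: list_all2_conv_all_nth intro!: nth_equalityI)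
  with comp.IH(2) ys'(2) show ?case by blast
next
  case (rec_0 f xs y g)
  from rec_0.prems have "computes f xs z" by (cases rule: computes.cases) simp_all
  then show ?case by (rule rec_0.IH)
next
  case (rec_Suc f g n xs y w)
  from rec_Suc.prems obtain y' where y': "computes (PrimRec f g) (n # xs) y'"
    and z: "computes g (n # y' # xs) z"
    by (cases rule: computes.cases) simp_all
  from rec_Suc.IH(1)[OF y'] z show ?case by (intro rec_Suc.IH(2)) simp
next
  case (mu f n xs)
  from mu.prems have z: "computes f (z # xs) 0"
    and less: "\<And>m. m < z \<Longrightarrow> \<exists>y. computes f (m # xs) (Suc y)"
    by (cases rule: computes.cases; simp)+
  have "\<not> n < z"
    using less[of n] mu.IH(1) by blast
  moreover have "\<not> z < n"
    using mu.IH(2)[of z] z by blast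
  ultimately show ?case by simp
qed

definition matrix_code :: "int ^ 2 ^ 2 \<Rightarrow> nat" where
  "matrix_code A = list_encode (map int_encode [A $ 1 $ 1, A $ 1 $ 2, A $ 2 $ 1, A $ 2 $ 2])"

definition matrices_code :: "(int ^ 2 ^ 2) list \<Rightarrow> nat" where
  "matrices_code As = list_encode (map matrix_code As)"

lemma inj_matrix_code: "inj matrix_code"
  by (rule injI) (simp add: matrix_code_def int_encode_eq vec_eq_iff forall_2)

lemma inj_matrices_code: "inj matrices_code"
  by (rule injI) (simp add: matrices_code_def list_encode_eq inj_map_eq_map[OF inj_matrix_code])

definition generated_semigroup :: "(int ^ 2 ^ 2) set \<Rightarrow> (int ^ 2 ^ 2) set" where
  "generated_semigroup F =
     {M. M = mat 1 \<or> (\<exists>Ms. Ms \<noteq> [] \<and> set Ms \<subseteq> F \<and> M = foldr (**) Ms (mat 1))}"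

end

theory Submission imports Defs
begin

text \<open>
  Call an integer matrix positive (negative) if both of its columns lie in the closed first or third
  (second or fourth) quadrants. A nonsingular matrix that is neither has entries bounded by
  \<open>\<bar>det\<bar>\<close>. If \<open>h\<close> is negative and \<open>h ** s\<close> is positive, then there is no cancellation in
  \<open>adj h ** (h ** s) = det h * s\<close>, so \<open>h\<close> is bounded in terms of \<open>s\<close> and the determinant. Hence the
  partial products of a word that goes from negative to positive pass through a small matrix.

  Let \<open>X\<close> be a product of generators. A large positive matrix is divisible on the left by one of the
  elementary matrices \<open>(1 1; 0 1)\<close> and \<open>(1 0; 1 1)\<close> with a smaller positive quotient (Euclid's
  algorithm on the rows). Translating by these factors one after the other and applying the crossing
  argument each time cuts every word for \<open>X\<close> into few pieces whose products lie in a fixed finite ball.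
  Now split off the first letter of a shortest word for a matrix in the ball and cut the rest: the
  length is at most \<open>1 + C * m\<close>, where \<open>m\<close> is a smaller shortest length of a matrix in the ball. As the
  ball is finite, this bounds all shortest lengths by \<open>(C + 1) ^ card ball\<close>, a primitive recursive
  function of the input, and membership is decided by searching all words up to this length.
\<close>

section \<open>Crossing from negative to positive matrices\<close>

lemma matrix_mult_2:
  fixes A B :: "int ^ 2 ^ 2"
  shows "(A ** B) $ i $ j = A $ i $ 1 * B $ 1 $ j + A $ i $ 2 * B $ 2 $ j"
  by (simp add: matrix_matrix_mult_def sum_2)

lemma matrix_eq_2:
  fixes A B :: "int ^ 2 ^ 2"
  shows "A = B \<longleftrightarrow> A $ 1 $ 1 = B $ 1 $ 1 \<and> A $ 1 $ 2 = B $ 1 $ 2 \<and>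
    A $ 2 $ 1 = B $ 2 $ 1 \<and> A $ 2 $ 2 = B $ 2 $ 2"
  by (simp add: vec_eq_iff forall_2)

definition mat2 :: "int \<Rightarrow> int \<Rightarrow> int \<Rightarrow> int \<Rightarrow> int ^ 2 ^ 2" where
  "mat2 a b c d = (\<chi> i j. if i = 1 then (if j = 1 then a else b) else (if j = 1 then c else d))"

lemma mat2_nth [simp]:
  "mat2 a b c d $ 1 $ 1 = a" "mat2 a b c d $ 1 $ 2 = b"
  "mat2 a b c d $ 2 $ 1 = c" "mat2 a b c d $ 2 $ 2 = d"
  by (simp_all add: mat2_def)

lemma mat_1_nth_2 [simp]:
  "(mat 1 :: int ^ 2 ^ 2) $ 1 $ 1 = 1" "(mat 1 :: int ^ 2 ^ 2) $ 1 $ 2 = 0"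
  "(mat 1 :: int ^ 2 ^ 2) $ 2 $ 1 = 0" "(mat 1 :: int ^ 2 ^ 2) $ 2 $ 2 = 1"
  by (simp_all add: mat_def)

definition mbound :: "int ^ 2 ^ 2 \<Rightarrow> int \<Rightarrow> bool" where
  "mbound A k \<longleftrightarrow> \<bar>A $ 1 $ 1\<bar> \<le> k \<and> \<bar>A $ 1 $ 2\<bar> \<le> k \<and> \<bar>A $ 2 $ 1\<bar> \<le> k \<and> \<bar>A $ 2 $ 2\<bar> \<le> k"

definition posM :: "int ^ 2 ^ 2 \<Rightarrow> bool" where
  "posM A \<longleftrightarrow> A $ 1 $ 1 * A $ 2 $ 1 \<ge> 0 \<and> A $ 1 $ 2 * A $ 2 $ 2 \<ge> 0"

definition negM :: "int ^ 2 ^ 2 \<Rightarrow> bool" where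
  "negM A \<longleftrightarrow> A $ 1 $ 1 * A $ 2 $ 1 \<le> 0 \<and> A $ 1 $ 2 * A $ 2 $ 2 \<le> 0"

definition msize :: "int ^ 2 ^ 2 \<Rightarrow> nat" where
  "msize A = nat (\<bar>A $ 1 $ 1\<bar> + \<bar>A $ 1 $ 2\<bar> + \<bar>A $ 2 $ 1\<bar> + \<bar>A $ 2 $ 2\<bar>)"

lemma mbound_mono: "mbound A k \<Longrightarrow> k \<le> l \<Longrightarrow> mbound A l"
  by (auto simp: mbound_def)

lemma abs_diff_opposite:
  fixes x y :: int
  assumes "x * y \<le> 0"
  shows "\<bar>x - y\<bar> = \<bar>x\<bar> + \<bar>y\<bar>"
  using assms by (auto simp: mult_le_0_iff)

lemma abs_le_abs_mult_int:
  fixes x y :: int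
  assumes "x \<noteq> 0"
  shows "\<bar>y\<bar> \<le> \<bar>x\<bar> * \<bar>y\<bar>"
proof -
  have "1 * \<bar>y\<bar> \<le> \<bar>x\<bar> * \<bar>y\<bar>"
    using assms by (intro mult_right_mono) auto
  then show ?thesis by simp
qed

lemma abs_le_if_mult_le:
  fixes x y D :: int
  assumes "\<bar>x * y\<bar> \<le> D" "x * y \<noteq> 0"
  shows "\<bar>x\<bar> \<le> D" "\<bar>y\<bar> \<le> D"
proof -
  have "x \<noteq> 0" "y \<noteq> 0" using assms(2) by auto
  then have "\<bar>y\<bar> \<le> \<bar>x\<bar> * \<bar>y\<bar>" "\<bar>x\<bar> \<le> \<bar>y\<bar> * \<bar>x\<bar>"
    by (auto intro: abs_le_abs_mult_int)
  moreover have "\<bar>x\<bar> * \<bar>y\<bar> \<le> D" "\<bar>y\<bar> * \<bar>x\<bar> \<le> D"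
    using assms(1) by (simp_all add: abs_mult mult.commute)
  ultimately show "\<bar>x\<bar> \<le> D" "\<bar>y\<bar> \<le> D" by linarith+
qed

lemma abs_dot_le:
  fixes a b c d k l :: int
  assumes "\<bar>a\<bar> \<le> k" "\<bar>b\<bar> \<le> l" "\<bar>c\<bar> \<le> k" "\<bar>d\<bar> \<le> l"
  shows "\<bar>a * b + c * d\<bar> \<le> 2 * k * l" "\<bar>a * b - c * d\<bar> \<le> 2 * k * l"
proof -
  have "\<bar>a\<bar> * \<bar>b\<bar> \<le> k * l" "\<bar>c\<bar> * \<bar>d\<bar> \<le> k * l"
    using assms by (auto intro!: mult_mono)
  then have "\<bar>a * b\<bar> \<le> k * l" "\<bar>c * d\<bar> \<le> k * l"
    by (simp_all add: abs_mult)
  then show "\<bar>a * b + c * d\<bar> \<le> 2 * k * l" "\<bar>a * b - c * d\<bar> \<le> 2 * k * l"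
    by linarith+
qed

text \<open>The adjugate of \<open>A\<close> times \<open>B\<close> is \<open>det A\<close> times
  \<open>X\<close>. Its entries are at most \<open>2 * k * l\<close>, and as \<open>det A\<close> is
  a nonzero integer, dividing by it does not enlarge them.\<close>

lemma mbound_left_cancel:
  assumes "A ** X = B" "det A \<noteq> 0" "mbound A k" "mbound B l"
  shows "mbound X (2 * k * l)"
proof -
  have B: "B $ i $ j = A $ i $ 1 * X $ 1 $ j + A $ i $ 2 * X $ 2 $ j" for i j
    using assms(1) by (auto simp: matrix_mult_2)
  have 1: "det A * X $ 1 $ j = A $ 2 $ 2 * B $ 1 $ j - A $ 1 $ 2 * B $ 2 $ j" for j
    unfolding B det_2 by algebra
  have 2: "det A * X $ 2 $ j = A $ 1 $ 1 * B $ 2 $ j - A $ 2 $ 1 * B $ 1 $ j" for j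
    unfolding B det_2 by algebra
  have le: "\<bar>x\<bar> \<le> \<bar>det A * x\<bar>" for x
    using abs_le_abs_mult_int[OF assms(2)] by (simp add: abs_mult)
  have "\<bar>X $ i $ j\<bar> \<le> 2 * k * l" if "i = 1 \<or> i = 2" "j = 1 \<or> j = 2" for i j
  proof -
    have "\<bar>det A * X $ 1 $ j\<bar> \<le> 2 * k * l" unfolding 1
      by (rule abs_dot_le) (use that(2) assms(3,4) in \<open>auto simp: mbound_def\<close>)
    moreover have "\<bar>det A * X $ 2 $ j\<bar> \<le> 2 * k * l" unfolding 2
      by (rule abs_dot_le) (use that(2) assms(3,4) in \<open>auto simp: mbound_def\<close>)
    ultimately show ?thesis
      using that(1) le[of "X $ i $ j"] by (elim disjE) (hypsubst, linarith)+
  qed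
  then show ?thesis by (simp add: mbound_def)
qed

lemma mbound_right_cancel:
  assumes "X ** A = B" "det A \<noteq> 0" "mbound A k" "mbound B l"
  shows "mbound X (2 * k * l)"
proof -
  have B: "B $ i $ j = X $ i $ 1 * A $ 1 $ j + X $ i $ 2 * A $ 2 $ j" for i j
    using assms(1) by (auto simp: matrix_mult_2)
  have 1: "det A * X $ i $ 1 = A $ 2 $ 2 * B $ i $ 1 - A $ 2 $ 1 * B $ i $ 2" for i
    unfolding B det_2 by algebra
  have 2: "det A * X $ i $ 2 = A $ 1 $ 1 * B $ i $ 2 - A $ 1 $ 2 * B $ i $ 1" for i
    unfolding B det_2 by algebra
  have le: "\<bar>x\<bar> \<le> \<bar>det A * x\<bar>" for x
    using abs_le_abs_mult_int[OF assms(2)] by (simp add: abs_mult)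
  have "\<bar>X $ i $ j\<bar> \<le> 2 * k * l" if "i = 1 \<or> i = 2" "j = 1 \<or> j = 2" for i j
  proof -
    have "\<bar>det A * X $ i $ 1\<bar> \<le> 2 * k * l" unfolding 1
      by (rule abs_dot_le) (use that(1) assms(3,4) in \<open>auto simp: mbound_def\<close>)
    moreover have "\<bar>det A * X $ i $ 2\<bar> \<le> 2 * k * l" unfolding 2
      by (rule abs_dot_le) (use that(1) assms(3,4) in \<open>auto simp: mbound_def\<close>)
    ultimately show ?thesis
      using that(2) le[of "X $ i $ j"] by (elim disjE) (hypsubst, linarith)+
  qed
  then show ?thesis by (simp add: mbound_def)
qed

section \<open>Matrices bounded through their determinants\<close>

lemma mbound_of_products:
  fixes A :: "int ^ 2 ^ 2"
  assumes "A $ 1 $ 1 * A $ 2 $ 2 \<noteq> 0" "A $ 1 $ 2 * A $ 2 $ 1 \<noteq> 0"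
    and "\<bar>A $ 1 $ 1 * A $ 2 $ 2\<bar> \<le> D" "\<bar>A $ 1 $ 2 * A $ 2 $ 1\<bar> \<le> D"
  shows "mbound A D"
  unfolding mbound_def using abs_le_if_mult_le[OF assms(3,1)] abs_le_if_mult_le[OF assms(4,2)] by simp

text \<open>One column has strictly opposite signs and the other strictly equal signs, so the two
  terms of the determinant have opposite signs. They cannot cancel, and none of the four entries is
  zero.\<close>

lemma mbound_mixed:
  assumes "\<not> posM A" "\<not> negM A" "\<bar>det A\<bar> \<le> D"
  shows "mbound A D"
proof -
  have "(A $ 1 $ 1 * A $ 2 $ 1 < 0 \<and> 0 < A $ 1 $ 2 * A $ 2 $ 2) \<or>
    (0 < A $ 1 $ 1 * A $ 2 $ 1 \<and> A $ 1 $ 2 * A $ 2 $ 2 < 0)"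
    using assms(1,2) unfolding posM_def negM_def by linarith
  then have "(A $ 1 $ 1 * A $ 2 $ 1) * (A $ 1 $ 2 * A $ 2 $ 2) < 0"
    by (metis mult_pos_neg mult_neg_pos)
  then have *: "(A $ 1 $ 1 * A $ 2 $ 2) * (A $ 1 $ 2 * A $ 2 $ 1) < 0"
    by (simp add: algebra_simps)
  then have "\<bar>A $ 1 $ 1 * A $ 2 $ 2\<bar> + \<bar>A $ 1 $ 2 * A $ 2 $ 1\<bar> \<le> D"
    using abs_diff_opposite[of "A $ 1 $ 1 * A $ 2 $ 2" "A $ 1 $ 2 * A $ 2 $ 1"] assms(3)
    by (simp add: det_2)
  then show ?thesis
    using * by (intro mbound_of_products) auto
qed

text \<open>Both sign conditions together put a zero into each column, so a nonsingular matrix is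
  diagonal or antidiagonal, and its determinant is up to sign the product of the two nonzero
  entries.\<close>

lemma mbound_pos_neg:
  assumes "posM A" "negM A" "det A \<noteq> 0" "\<bar>det A\<bar> \<le> D"
  shows "mbound A D"
proof -
  have "A $ 1 $ 1 * A $ 2 $ 1 = 0" "A $ 1 $ 2 * A $ 2 $ 2 = 0"
    using assms(1,2) by (auto simp: posM_def negM_def)
  then show ?thesis
    using assms(3,4) abs_le_if_mult_le[of "A $ 1 $ 1" "A $ 2 $ 2" D]
      abs_le_if_mult_le[of "A $ 1 $ 2" "A $ 2 $ 1" D]
    by (auto simp: det_2 mbound_def)
qed

lemma mbound_crossing:
  assumes "negM h" "posM (h ** s)" "mbound s r" "det (h ** s) \<noteq> 0" "\<bar>det h\<bar> \<le> D"
  shows "mbound h (D * r)"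
proof -
  define g where "g = h ** s"
  have g: "g $ i $ j = h $ i $ 1 * s $ 1 $ j + h $ i $ 2 * s $ 2 $ j" for i j
    by (simp add: g_def matrix_mult_2)
  \<comment> \<open>Up to sign, these are the entries of
    \<open>adj h ** g = det h * s\<close>.\<close>
  have 1: "h $ 2 $ 2 * g $ 1 $ j - h $ 1 $ 2 * g $ 2 $ j = det h * s $ 1 $ j"
   and 2: "h $ 2 $ 1 * g $ 1 $ j - h $ 1 $ 1 * g $ 2 $ j = - (det h * s $ 2 $ j)" for j
    unfolding g det_2 by algebra+
  have s: "\<bar>det h * s $ i $ j\<bar> \<le> D * r" if "i = 1 \<or> i = 2" "j = 1 \<or> j = 2" for i j
    unfolding abs_mult using assms(3,5) that by (intro mult_mono) (auto simp: mbound_def)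
  \<comment> \<open>Regrouped, each product is a column product of \<open>h\<close>, nonpositive by
    \<open>negM\<close>, times one of \<open>g\<close>, nonnegative by \<open>posM\<close>.\<close>
  have opp1: "(h $ 2 $ 2 * g $ 1 $ j) * (h $ 1 $ 2 * g $ 2 $ j) \<le> 0"
   and opp2: "(h $ 2 $ 1 * g $ 1 $ j) * (h $ 1 $ 1 * g $ 2 $ j) \<le> 0"
    if "j = 1 \<or> j = 2" for j
  proof -
    have "g $ 1 $ j * g $ 2 $ j \<ge> 0"
      using assms(2) that by (auto simp: posM_def g_def)
    moreover have "h $ 1 $ 2 * h $ 2 $ 2 \<le> 0" "h $ 1 $ 1 * h $ 2 $ 1 \<le> 0"
      using assms(1) by (auto simp: negM_def)
    ultimately have "(h $ 1 $ 2 * h $ 2 $ 2) * (g $ 1 $ j * g $ 2 $ j) \<le> 0"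
      "(h $ 1 $ 1 * h $ 2 $ 1) * (g $ 1 $ j * g $ 2 $ j) \<le> 0"
      by (simp_all add: mult_nonpos_nonneg)
    then show "(h $ 2 $ 2 * g $ 1 $ j) * (h $ 1 $ 2 * g $ 2 $ j) \<le> 0"
      "(h $ 2 $ 1 * g $ 1 $ j) * (h $ 1 $ 1 * g $ 2 $ j) \<le> 0"
      by (simp_all add: algebra_simps)
  qed
  have sum1: "\<bar>h $ 2 $ 2\<bar> * \<bar>g $ 1 $ j\<bar> + \<bar>h $ 1 $ 2\<bar> * \<bar>g $ 2 $ j\<bar> \<le> D * r"
   and sum2: "\<bar>h $ 2 $ 1\<bar> * \<bar>g $ 1 $ j\<bar> + \<bar>h $ 1 $ 1\<bar> * \<bar>g $ 2 $ j\<bar> \<le> D * r"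
    if "j = 1 \<or> j = 2" for j
    using abs_diff_opposite[OF opp1[OF that]] abs_diff_opposite[OF opp2[OF that]]
      s[of 1 j] s[of 2 j] that unfolding 1 2 by (auto simp: abs_mult)
  \<comment> \<open>An entry of \<open>h\<close> is weighted in its two sums by the entries of one
    row of \<open>g\<close>. That row is nonzero because \<open>g\<close> is nonsingular, so one
    weight is at least 1.\<close>
  have le: "\<bar>x\<bar> \<le> D * r"
    if "\<bar>x\<bar> * \<bar>a\<bar> + \<bar>y\<bar> * \<bar>b\<bar> \<le> D * r" "\<bar>x\<bar> * \<bar>c\<bar> + \<bar>y\<bar> * \<bar>d\<bar> \<le> D * r" "a \<noteq> 0 \<or> c \<noteq> 0"
    for x y a b c d :: int
  proof -
    have "\<bar>y\<bar> * \<bar>b\<bar> \<ge> 0" "\<bar>y\<bar> * \<bar>d\<bar> \<ge> 0" by simp_all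
    moreover have "\<bar>x\<bar> \<le> \<bar>x\<bar> * \<bar>a\<bar> \<or> \<bar>x\<bar> \<le> \<bar>x\<bar> * \<bar>c\<bar>"
      using that(3) abs_le_abs_mult_int[of a x] abs_le_abs_mult_int[of c x] by (auto simp: mult.commute)
    ultimately show ?thesis using that(1,2) by linarith
  qed
  have row: "g $ 1 $ 1 \<noteq> 0 \<or> g $ 1 $ 2 \<noteq> 0" "g $ 2 $ 1 \<noteq> 0 \<or> g $ 2 $ 2 \<noteq> 0"
    using assms(4) by (auto simp: det_2 g_def)
  have "\<bar>h $ 2 $ 2\<bar> \<le> D * r" "\<bar>h $ 2 $ 1\<bar> \<le> D * r"
    using le[OF sum1[of 1] sum1[of 2] row(1)] le[OF sum2[of 1] sum2[of 2] row(1)] by auto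
  \<comment> \<open>With the summands swapped, \<open>le\<close> bounds the first row of
    \<open>h\<close> by means of the second row of \<open>g\<close>.\<close>
  moreover have "\<bar>h $ 1 $ 2\<bar> * \<bar>g $ 2 $ j\<bar> + \<bar>h $ 2 $ 2\<bar> * \<bar>g $ 1 $ j\<bar> \<le> D * r"
    "\<bar>h $ 1 $ 1\<bar> * \<bar>g $ 2 $ j\<bar> + \<bar>h $ 2 $ 1\<bar> * \<bar>g $ 1 $ j\<bar> \<le> D * r"
    if "j = 1 \<or> j = 2" for j
    using sum1[OF that] sum2[OF that] by linarith+
  from le[OF this(1) this(1) row(2)] le[OF this(2) this(2) row(2)]
  have "\<bar>h $ 1 $ 2\<bar> \<le> D * r" "\<bar>h $ 1 $ 1\<bar> \<le> D * r" by simp_all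
  ultimately show ?thesis by (simp add: mbound_def)
qed

section \<open>Partial products of words, and Euclid's algorithm on the rows\<close>

abbreviation wprod :: "(int ^ 2 ^ 2) list \<Rightarrow> int ^ 2 ^ 2" where
  "wprod ws \<equiv> foldr (**) ws (mat 1)"

lemma wprod_append: "wprod (us @ vs) = wprod us ** wprod vs"
  by (induction us) (simp_all add: matrix_mul_assoc)

lemma det_wprod_ne_0: "(\<forall>s \<in> set ws. det s \<noteq> 0) \<Longrightarrow> det (wprod ws) \<noteq> 0"
  by (induction ws) (simp_all add: det_mul)

lemma abs_det_le_mult:
  fixes A B :: "int ^ 2 ^ 2"
  assumes "det B \<noteq> 0"
  shows "\<bar>det A\<bar> \<le> \<bar>det (A ** B)\<bar>" "\<bar>det A\<bar> \<le> \<bar>det (B ** A)\<bar>"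
  using abs_le_abs_mult_int[OF assms, of "det A"] by (simp_all add: det_mul abs_mult mult.commute)

text \<open>The cut falls just before the first letter after which the product is no longer
  negative. If it is positive there, \<open>mbound_crossing\<close> applies. If it is neither, it is
  small by \<open>mbound_mixed\<close>, and cancelling that letter costs the factor 2. Prefixes
  inherit the bound \<open>D\<close> because every letter has a nonzero integer determinant.\<close>

lemma crossing:
  assumes "negM y" "\<not> negM (y ** wprod ws)" "det (y ** wprod ws) \<noteq> 0" "\<bar>det (y ** wprod ws)\<bar> \<le> D"
    and "\<forall>s \<in> set ws. mbound s r \<and> det s \<noteq> 0" and "0 \<le> r"
  shows "\<exists>us vs. ws = us @ vs \<and> negM (y ** wprod us) \<and> mbound (y ** wprod us) (2 * D * r)"
  using assms
proof (induction ws arbitrary: y)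
  case Nil
  then show ?case by simp
next
  case (Cons s ws)
  have D: "0 \<le> D" using Cons.prems(4) by linarith
  show ?case
  proof (cases "negM (y ** s)")
    case True
    from Cons.IH[OF True] Cons.prems obtain us vs where
      "ws = us @ vs" "negM (y ** s ** wprod us)" "mbound (y ** s ** wprod us) (2 * D * r)"
      by (auto simp: matrix_mul_assoc)
    then show ?thesis
      by (intro exI[of _ "s # us"] exI[of _ vs]) (auto simp: matrix_mul_assoc)
  next
    case False
    have w: "det (wprod ws) \<noteq> 0" using Cons.prems by (intro det_wprod_ne_0) auto
    have s: "mbound s r" "det s \<noteq> 0" using Cons.prems by auto
    have ys: "det (y ** s) \<noteq> 0" using Cons.prems(3) by (auto simp: det_mul)
    have dys: "\<bar>det (y ** s)\<bar> \<le> D"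
      using abs_det_le_mult(1)[OF w, of "y ** s"] Cons.prems(4) by (simp add: matrix_mul_assoc)
    have dy: "\<bar>det y\<bar> \<le> D"
      using abs_det_le_mult(1)[OF s(2), of y] dys by linarith
    have "mbound y (2 * D * r)"
    proof (cases "posM (y ** s)")
      case True
      from mbound_crossing[OF Cons.prems(1) True s(1) ys dy] show ?thesis
        by (rule mbound_mono) (use D \<open>0 \<le> r\<close> in simp)
    next
      case pos: False
      from mbound_mixed[OF pos False dys] have "mbound (y ** s) D" .
      from mbound_right_cancel[OF refl s(2,1) this] show ?thesis
        by (simp add: mult.commute mult.left_commute)
    qed
    then show ?thesis
      using Cons.prems(1) by (intro exI[of _ "[]"] exI[of _ "s # ws"]) simp
  qed
qed

text \<open>One step of Euclid's algorithm: \<open>v\<close> subtracts the row that is smaller in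
  both columns from the other, and \<open>u\<close> adds it back. Since \<open>v\<close> keeps
  negative matrices negative, a negative starting point can be translated together with
  \<open>P\<close>.\<close>

lemma posM_reduce:
  assumes "posM P" "det P \<noteq> 0" "\<bar>det P\<bar> \<le> D" "\<not> mbound P D"
  shows "\<exists>u v. u ** v = mat 1 \<and> det v = 1 \<and> posM (v ** P) \<and> msize (v ** P) < msize P \<and>
    (\<forall>h. negM h \<longrightarrow> negM (v ** h)) \<and> (\<forall>h k. mbound h k \<longrightarrow> mbound (u ** h) (2 * k))"
proof -
  obtain a b c d where P: "P $ 1 $ 1 = a" "P $ 1 $ 2 = b" "P $ 2 $ 1 = c" "P $ 2 $ 2 = d" by simp
  have pos: "a * c \<ge> 0" "b * d \<ge> 0" using assms(1) P by (auto simp: posM_def)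
  have det: "a * d - b * c \<noteq> 0" "\<bar>a * d - b * c\<bar> \<le> D" using assms(2,3) P by (auto simp: det_2)
  \<comment> \<open>Strictly larger entries \<open>x\<close>, \<open>z\<close> on a diagonal would
    make the determinant at least \<open>\<bar>x\<bar> + \<bar>z\<bar> - 1\<close> in absolute
    value, which exceeds \<open>D\<close> as soon as one of them does. Hence one row dominates the
    other.\<close>
  have cross: False if "\<bar>w\<bar> < \<bar>x\<bar>" "\<bar>y\<bar> < \<bar>z\<bar>" "x * w \<ge> 0" "y * z \<ge> 0" "\<bar>x * z - y * w\<bar> \<le> D"
    "\<not> (\<bar>x\<bar> \<le> D \<and> \<bar>z\<bar> \<le> D)" for x y z w
  proof -
    have "(x * w) * (y * z) \<ge> 0" using that(3,4) by (rule mult_nonneg_nonneg)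
    then have "(x * z) * (y * w) \<ge> 0" by (simp add: algebra_simps)
    then have "\<bar>x\<bar> * \<bar>z\<bar> - \<bar>y\<bar> * \<bar>w\<bar> \<le> \<bar>x * z - y * w\<bar>"
      by (simp add: abs_mult[symmetric])
    moreover have "\<bar>y\<bar> * \<bar>w\<bar> \<le> (\<bar>z\<bar> - 1) * (\<bar>x\<bar> - 1)"
      using that(1,2) by (intro mult_mono) auto
    moreover have "(\<bar>z\<bar> - 1) * (\<bar>x\<bar> - 1) = \<bar>x\<bar> * \<bar>z\<bar> - \<bar>x\<bar> - \<bar>z\<bar> + 1"
      by (simp add: algebra_simps)
    ultimately show False using that(1,2,5,6) by linarith
  qed
  have small: "\<not> (\<bar>a\<bar> \<le> D \<and> \<bar>b\<bar> \<le> D \<and> \<bar>c\<bar> \<le> D \<and> \<bar>d\<bar> \<le> D)"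
    using assms(4) P by (auto simp: mbound_def)
  have "(\<bar>c\<bar> \<le> \<bar>a\<bar> \<and> \<bar>d\<bar> \<le> \<bar>b\<bar>) \<or> (\<bar>a\<bar> \<le> \<bar>c\<bar> \<and> \<bar>b\<bar> \<le> \<bar>d\<bar>)"
  proof (rule ccontr)
    assume "\<not> ?thesis"
    then have "(\<bar>c\<bar> < \<bar>a\<bar> \<and> \<bar>b\<bar> < \<bar>d\<bar>) \<or> (\<bar>a\<bar> < \<bar>c\<bar> \<and> \<bar>d\<bar> < \<bar>b\<bar>)" by linarith
    then show False
    proof (elim disjE conjE)
      assume *: "\<bar>c\<bar> < \<bar>a\<bar>" "\<bar>b\<bar> < \<bar>d\<bar>"
      from cross[OF * pos det(2)] small * show False by linarith
    next
      assume *: "\<bar>a\<bar> < \<bar>c\<bar>" "\<bar>d\<bar> < \<bar>b\<bar>"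
      have "c * a \<ge> 0" "d * b \<ge> 0" "\<bar>c * b - d * a\<bar> \<le> D"
        using pos det(2) by (simp_all add: algebra_simps abs_minus_commute)
      from cross[OF * this] small * show False by linarith
    qed
  qed
  moreover have sub: "(x - y) * y \<ge> 0 \<and> \<bar>x - y\<bar> = \<bar>x\<bar> - \<bar>y\<bar>"
    if "x * y \<ge> 0" "\<bar>y\<bar> \<le> \<bar>x\<bar>" for x y :: int
  proof -
    have "(0 \<le> x \<and> 0 \<le> y) \<or> (x \<le> 0 \<and> y \<le> 0)" using that by (auto simp: zero_le_mult_iff)
    then show ?thesis
    proof (elim disjE conjE)
      assume "0 \<le> x" "0 \<le> y"
      then show ?thesis using that(2) by simp
    next
      assume "x \<le> 0" "y \<le> 0"
      then show ?thesis using that(2) by (simp add: mult_nonpos_nonpos)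
    qed
  qed
  \<comment> \<open>Subtracting a number of opposite sign only moves \<open>x\<close> further away
    from it; this is why \<open>v\<close> preserves \<open>negM\<close>.\<close>
  moreover have neg: "(x - y) * y \<le> 0" if "x * y \<le> 0" for x y :: int
    using that zero_le_square[of y] unfolding left_diff_distrib by linarith
  ultimately show ?thesis
  proof (elim disjE conjE)
    assume le: "\<bar>c\<bar> \<le> \<bar>a\<bar>" "\<bar>d\<bar> \<le> \<bar>b\<bar>"
    \<comment> \<open>The subtracted row is nonzero because \<open>P\<close> is nonsingular, so the
      size drops strictly.\<close>
    have nz: "0 < \<bar>c\<bar> + \<bar>d\<bar>" "0 < \<bar>a\<bar> + \<bar>b\<bar> + \<bar>c\<bar> + \<bar>d\<bar>"
      using det(1) by (cases "c = 0"; cases "d = 0"; auto)+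
    let ?u = "mat2 1 1 0 1" and ?v = "mat2 1 (-1) 0 1"
    have "posM (?v ** P)"
      using sub[OF pos(1) le(1)] sub[OF pos(2) le(2)]
      by (simp add: posM_def matrix_mult_2 P mult.commute)
    moreover have "msize (?v ** P) < msize P"
      using nz conjunct2[OF sub[OF pos(1) le(1)]] conjunct2[OF sub[OF pos(2) le(2)]]
      by (auto simp: msize_def matrix_mult_2 P)
    moreover have "negM (?v ** h)" if "negM h" for h
      using that neg[of "h $ 1 $ 1" "h $ 2 $ 1"] neg[of "h $ 1 $ 2" "h $ 2 $ 2"]
        neg[of "h $ 2 $ 1" "h $ 1 $ 1"] neg[of "h $ 2 $ 2" "h $ 1 $ 2"]
      by (simp add: negM_def matrix_mult_2 mult.commute)
    moreover have "mbound (?u ** h) (2 * k)" if "mbound h k" for h k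
      using that unfolding mbound_def matrix_mult_2 mat2_nth by linarith
    moreover have "?u ** ?v = mat 1" "det ?v = 1"
      by (simp_all add: matrix_eq_2 matrix_mult_2 det_2)
    ultimately show ?thesis by blast
  next
    assume le: "\<bar>a\<bar> \<le> \<bar>c\<bar>" "\<bar>b\<bar> \<le> \<bar>d\<bar>"
    have pos': "c * a \<ge> 0" "d * b \<ge> 0" using pos by (simp_all add: mult.commute)
    have nz: "0 < \<bar>a\<bar> + \<bar>b\<bar>" "0 < \<bar>a\<bar> + \<bar>b\<bar> + \<bar>c\<bar> + \<bar>d\<bar>"
      using det(1) by (cases "a = 0"; cases "b = 0"; auto)+
    let ?u = "mat2 1 0 1 1" and ?v = "mat2 1 0 (-1) 1"
    have "posM (?v ** P)"
      using sub[OF pos'(1) le(1)] sub[OF pos'(2) le(2)]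
      by (simp add: posM_def matrix_mult_2 P mult.commute)
    moreover have "msize (?v ** P) < msize P"
      using nz conjunct2[OF sub[OF pos'(1) le(1)]] conjunct2[OF sub[OF pos'(2) le(2)]]
      by (auto simp: msize_def matrix_mult_2 P)
    moreover have "negM (?v ** h)" if "negM h" for h
      using that neg[of "h $ 1 $ 1" "h $ 2 $ 1"] neg[of "h $ 1 $ 2" "h $ 2 $ 2"]
        neg[of "h $ 2 $ 1" "h $ 1 $ 1"] neg[of "h $ 2 $ 2" "h $ 1 $ 2"]
      by (simp add: negM_def matrix_mult_2 mult.commute)
    moreover have "mbound (?u ** h) (2 * k)" if "mbound h k" for h k
      using that unfolding mbound_def matrix_mult_2 mat2_nth by linarith
    moreover have "?u ** ?v = mat 1" "det ?v = 1"
      by (simp_all add: matrix_eq_2 matrix_mult_2 det_2)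
    ultimately show ?thesis by blast
  qed
qed

section \<open>A bound for the length of shortest words\<close>

definition chopped :: "int \<Rightarrow> nat \<Rightarrow> (int ^ 2 ^ 2) list \<Rightarrow> bool" where
  "chopped b m ws \<longleftrightarrow>
    (\<exists>wss. ws = concat wss \<and> length wss \<le> m \<and> (\<forall>us \<in> set wss. mbound (wprod us) b))"

lemma msize_pos: "det P \<noteq> 0 \<Longrightarrow> 1 \<le> msize P"
  by (cases "P $ 1 $ 1 = 0"; cases "P $ 1 $ 2 = 0") (auto simp: msize_def det_2)

text \<open>
  The word leads from the small negative matrix \<open>y\<close> to \<open>P\<close>. Each induction step divides both by an
  elementary matrix, which keeps \<open>y\<close> negative, and cuts the word at the last negative partial product
  before the first crossing; that product is the next \<open>y\<close>.
\<close>

lemma chop_posM: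
  fixes D r k :: int
  assumes "1 \<le> D" "1 \<le> r" and k: "k = 2 * D * r"
    and "posM P" "det P \<noteq> 0" "\<bar>det P\<bar> \<le> D" "negM y" "mbound y k" "y ** wprod ws = P"
    and "\<forall>s \<in> set ws. mbound s r \<and> det s \<noteq> 0"
  shows "chopped (4 * k * k) (msize P) ws"
  using assms(4-)
proof (induction "msize P" arbitrary: P y ws rule: less_induct)
  case less
  have "1 * 1 \<le> D * r" by (rule mult_mono) (use assms(1,2) in auto)
  moreover have "D * 1 \<le> D * r" by (rule mult_left_mono) (use assms(1,2) in auto)
  ultimately have Dk: "2 * D \<le> k" "0 \<le> k" using assms(1) unfolding k by linarith+
  have dety: "det y \<noteq> 0" using less.prems(2,6) by (auto simp: det_mul)
  show ?case
  proof (cases "mbound P (2 * D)")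
    case True
    have "mbound (wprod ws) (2 * k * (2 * D))"
      by (rule mbound_left_cancel[OF less.prems(6) dety less.prems(5) True])
    moreover have "2 * k * (2 * D) \<le> 4 * k * k"
      using mult_left_mono[OF Dk(1), of "2 * k"] Dk mult_nonneg_nonneg[OF Dk(2,2)] by linarith
    ultimately have "mbound (wprod ws) (4 * k * k)" by (rule mbound_mono)
    then show ?thesis
      using msize_pos[OF less.prems(2)] unfolding chopped_def by (intro exI[of _ "[ws]"]) simp
  next
    case False
    then have "\<not> mbound P D" using mbound_mono assms(1) by fastforce
    from posM_reduce[OF less.prems(1-3) this] obtain u v where
      uv: "u ** v = mat 1" "det v = 1" "posM (v ** P)" "msize (v ** P) < msize P"
        and neg: "\<And>h. negM h \<Longrightarrow> negM (v ** h)"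
        and bd: "\<And>h k. mbound h k \<Longrightarrow> mbound (u ** h) (2 * k)"
      by blast
    have cancel: "u ** (v ** A) = A" for A
      using uv(1) by (simp add: matrix_mul_assoc)
    have det': "det (v ** P) = det P" using uv(2) by (simp add: det_mul)
    \<comment> \<open>Otherwise \<open>v ** P\<close> would be both positive and negative, hence
      bounded by \<open>D\<close>, and \<open>P = u ** (v ** P)\<close> by \<open>2 * D\<close>.
      This is why the case split is at \<open>2 * D\<close>.\<close>
    have "\<not> negM (v ** P)"
      using bd[of "v ** P" D] mbound_pos_neg[OF uv(3)] False less.prems(2,3)
      by (auto simp: cancel det')
    moreover have eq: "(v ** y) ** wprod ws = v ** P"
      using less.prems(6) by (simp add: matrix_mul_assoc[symmetric])
    ultimately obtain us vs where split: "ws = us @ vs" "negM (v ** y ** wprod us)"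
      "mbound (v ** y ** wprod us) k"
      using crossing[OF neg[OF less.prems(4)], of ws D r] less.prems(2,3,7) assms(2)
      unfolding eq det' k by auto
    \<comment> \<open>Translated back by \<open>u\<close>, the cut point is bounded by
      \<open>2 * k\<close>; cancelling \<open>y\<close>, bounded by \<open>k\<close>, gives the
      constant \<open>4 * k * k\<close>.\<close>
    have "y ** wprod us = u ** (v ** y ** wprod us)"
      unfolding matrix_mul_assoc[symmetric] cancel ..
    then have "mbound (wprod us) (2 * k * (2 * k))"
      using mbound_left_cancel[OF refl dety less.prems(5)] bd[OF split(3)] by metis
    then have us: "mbound (wprod us) (4 * k * k)" by (simp add: algebra_simps)
    \<comment> \<open>The remaining word leads from the new small negative matrix to the smaller
      positive matrix \<open>v ** P\<close>.\<close>
    have "chopped (4 * k * k) (msize (v ** P)) vs"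
      by (rule less.hyps[OF uv(4,3) _ _ split(2,3)])
        (use less.prems eq split(1) in \<open>auto simp: det' wprod_append matrix_mul_assoc simp del: foldr_append\<close>)
    then obtain wss where "vs = concat wss" "length wss \<le> msize (v ** P)"
      "\<forall>us \<in> set wss. mbound (wprod us) (4 * k * k)"
      unfolding chopped_def by blast
    then show ?thesis
      using split(1) us uv(4) unfolding chopped_def by (intro exI[of _ "us # wss"]) simp
  qed
qed

text \<open>A positive product is reached from the identity, which is also negative as each of its
  columns contains a zero. A negative product is multiplied on the left by \<open>?J\<close>, a
  small negative matrix that flips the second row and thus makes the product positive without
  changing its size. A product of neither kind is small, so the word is a single piece.\<close>

lemma chop:
  fixes D r k :: int
  assumes "1 \<le> D" "1 \<le> r" and k: "k = 2 * D * r"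
    and X: "\<bar>det (wprod ws)\<bar> \<le> D"
    and ws: "\<forall>s \<in> set ws. mbound s r \<and> det s \<noteq> 0"
  shows "chopped (4 * k * k) (msize (wprod ws)) ws"
proof -
  have "1 * 1 \<le> D * r" by (rule mult_mono) (use assms(1,2) in auto)
  moreover have "D * 1 \<le> D * r" by (rule mult_left_mono) (use assms(1,2) in auto)
  ultimately have Dk: "D \<le> k" "1 \<le> k" using assms(1) unfolding k by linarith+
  have det: "det (wprod ws) \<noteq> 0" using det_wprod_ne_0 ws by blast
  consider "posM (wprod ws)" | "negM (wprod ws)" | "\<not> posM (wprod ws)" "\<not> negM (wprod ws)" by blast
  then show ?thesis
  proof cases
    case 1
    show ?thesis
      by (rule chop_posM[OF assms(1-3) 1 det X, of "mat 1"])
        (use ws Dk in \<open>auto simp: negM_def mbound_def\<close>)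
  next
    case 2
    let ?J = "mat2 1 0 0 (-1)"
    have "chopped (4 * k * k) (msize (?J ** wprod ws)) ws"
      by (rule chop_posM[OF assms(1-3), of _ ?J])
        (use 2 det X ws Dk in \<open>auto simp: negM_def posM_def mbound_def matrix_mult_2 det_mul det_2[of ?J] abs_mult\<close>)
    then show ?thesis by (simp add: msize_def matrix_mult_2)
  next
    case 3
    from mbound_mixed[OF 3 X] have "mbound (wprod ws) D" .
    moreover have "1 * D \<le> 4 * k * k"
      by (rule mult_mono) (use Dk assms(1) in auto)
    ultimately have "mbound (wprod ws) (4 * k * k)" by (auto intro: mbound_mono)
    then show ?thesis
      using msize_pos[OF det] unfolding chopped_def by (intro exI[of _ "[ws]"]) simp
  qed
qed

section \<open>From pieces to a bound on shortest lengths\<close>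

lemma recursive_bound:
  fixes V :: "nat set" and C :: nat
  assumes fin: "finite V" and "1 \<le> C"
    and step: "\<And>l. l \<in> V \<Longrightarrow> l = 0 \<or> (\<exists>m < l. (m = 0 \<or> m \<in> V) \<and> l \<le> 1 + C * m)"
    and "l \<in> V"
  shows "l \<le> (C + 1) ^ card V"
proof -
  \<comment> \<open>Only the members up to \<open>l\<close> are counted in the exponent. Passing to
    \<open>m < l\<close> loses at least one of them, and \<open>1 + C * x \<le> (C + 1) * x\<close>
    for \<open>x \<ge> 1\<close>.\<close>
  have "l \<le> (C + 1) ^ card {v \<in> V. v \<le> l}" if "l \<in> V" for l
    using that
  proof (induction l rule: less_induct)
    case (less l)
    from step[OF less.prems] consider "l = 0" | "l \<le> 1"
      | m where "m < l" "m \<in> V" "l \<le> 1 + C * m" by force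
    then show ?case
    proof cases
      case 2
      moreover have "1 \<le> (C + 1) ^ card {v \<in> V. v \<le> l}" by simp
      ultimately show ?thesis by linarith
    next
      case 3
      let ?c = "card {v \<in> V. v \<le> m}"
      have "l \<in> {v \<in> V. v \<le> l}" "l \<notin> {v \<in> V. v \<le> m}" "{v \<in> V. v \<le> m} \<subseteq> {v \<in> V. v \<le> l}"
        using 3(1) less.prems by auto
      then have "{v \<in> V. v \<le> m} \<subset> {v \<in> V. v \<le> l}" by blast
      then have "Suc ?c \<le> card {v \<in> V. v \<le> l}"
        using fin by (intro Suc_leI psubset_card_mono) simp_all
      then have "(C + 1) ^ Suc ?c \<le> (C + 1) ^ card {v \<in> V. v \<le> l}"
        by (intro power_increasing) auto
      moreover have "C * m \<le> C * (C + 1) ^ ?c"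
        using less.IH[OF 3(1,2)] by (rule mult_left_mono) simp
      moreover have "1 \<le> (C + 1) ^ ?c" by simp
      ultimately show ?thesis using 3(3) unfolding power_Suc distrib_right by linarith
    qed simp
  qed
  from this[OF assms(4)] show ?thesis
    by (rule order_trans) (auto intro!: power_increasing card_mono fin)
qed

text \<open>Unspecified if \<open>X\<close> is not a product of elements of \<open>F\<close>; it is
  applied to such products only.\<close>

definition wlen :: "(int ^ 2 ^ 2) set \<Rightarrow> int ^ 2 ^ 2 \<Rightarrow> nat" where
  "wlen F X = (LEAST n. \<exists>ws. length ws = n \<and> set ws \<subseteq> F \<and> wprod ws = X)"

lemma wlen_le: "set ws \<subseteq> F \<Longrightarrow> wlen F (wprod ws) \<le> length ws"
  unfolding wlen_def by (intro Least_le) auto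

lemma wlen_word:
  assumes "set ws \<subseteq> F"
  obtains vs where "length vs = wlen F (wprod ws)" "set vs \<subseteq> F" "wprod vs = wprod ws"
proof -
  have "\<exists>n vs. length vs = n \<and> set vs \<subseteq> F \<and> wprod vs = wprod ws" using assms by blast
  from LeastI_ex[OF this] show ?thesis using that unfolding wlen_def by blast
qed

text \<open>Each piece is replaced by a shortest word with the same product.\<close>

lemma wlen_concat_le:
  assumes "\<And>us. us \<in> set wss \<Longrightarrow> set us \<subseteq> F \<and> wlen F (wprod us) \<le> m"
  shows "\<exists>vs. set vs \<subseteq> F \<and> wprod vs = wprod (concat wss) \<and> length vs \<le> length wss * m"
  using assms
proof (induction wss)
  case (Cons us wss)
  then obtain vs where "set vs \<subseteq> F" "wprod vs = wprod (concat wss)" "length vs \<le> length wss * m"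
    by auto
  moreover obtain us' where "length us' = wlen F (wprod us)" "set us' \<subseteq> F" "wprod us' = wprod us"
    using wlen_word Cons.prems by (metis list.set_intros(1))
  ultimately show ?case
    using Cons.prems[of us] by (intro exI[of _ "us' @ vs"]) (auto simp: wprod_append simp del: foldr_append)
qed simp

lemma finite_mbound: "finite {A. mbound A b}"
  and card_mbound: "card {A. mbound A b} \<le> nat (2 * b + 1) ^ 4"
proof -
  let ?I = "{-b..b}"
  let ?f = "\<lambda>(p, q, s, t). mat2 p q s t"
  have sub: "{A. mbound A b} \<subseteq> ?f ` (?I \<times> ?I \<times> ?I \<times> ?I)"
  proof
    fix A assume "A \<in> {A. mbound A b}"
    then have "A = ?f (A $ 1 $ 1, A $ 1 $ 2, A $ 2 $ 1, A $ 2 $ 2) \<and>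
      (A $ 1 $ 1, A $ 1 $ 2, A $ 2 $ 1, A $ 2 $ 2) \<in> ?I \<times> ?I \<times> ?I \<times> ?I"
      by (auto simp: matrix_eq_2 mbound_def abs_le_iff)
    then show "A \<in> ?f ` (?I \<times> ?I \<times> ?I \<times> ?I)" by blast
  qed
  show "finite {A. mbound A b}" using sub by (rule finite_subset) simp
  have "card {A. mbound A b} \<le> card (?I \<times> ?I \<times> ?I \<times> ?I)"
    by (rule surj_card_le[OF _ sub]) simp
  also have "\<dots> = nat (2 * b + 1) ^ 4"
    by (simp add: card_cartesian_product power4_eq_xxxx algebra_simps)
  finally show "card {A. mbound A b} \<le> nat (2 * b + 1) ^ 4" .
qed

lemma wlen_bound:
  fixes D r k b :: int
  assumes "1 \<le> D" "1 \<le> r" and k: "k = 2 * D * r" and b: "b = 4 * k * k"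
    and F: "\<forall>s \<in> F. mbound s r \<and> det s \<noteq> 0"
    and w0: "set w0 \<subseteq> F" "mbound (wprod w0) b" "\<bar>det (wprod w0)\<bar> \<le> D"
  shows "wlen F (wprod w0) \<le> (nat (8 * r * b) + 1) ^ (nat (2 * b + 1) ^ 4)"
proof -
  \<comment> \<open>The determinant bound is included because factors inherit it and
    \<open>chop\<close> requires it of the rest of a word.\<close>
  define B where "B = {X. mbound X b \<and> \<bar>det X\<bar> \<le> D \<and> (\<exists>ws. set ws \<subseteq> F \<and> wprod ws = X)}"
  define V where "V = wlen F ` B"
  \<comment> \<open>Without its first letter, a word for a matrix in \<open>B\<close> has a product
    with entries at most \<open>2 * r * b\<close>, hence of size at most \<open>8 * r * b\<close>.
    This bounds the number of pieces.\<close>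
  define C where "C = nat (8 * r * b)"
  have "1 * 1 \<le> D * r" by (rule mult_mono) (use assms(1,2) in auto)
  then have "1 \<le> k" unfolding k by linarith
  then have "1 * 1 \<le> k * k" by (intro mult_mono) auto
  then have b1: "1 \<le> b" unfolding b by linarith
  then have "1 * 1 \<le> r * b" using assms(2) by (intro mult_mono) auto
  then have C1: "1 \<le> C" unfolding C_def by linarith
  have B: "B \<subseteq> {A. mbound A b}" by (auto simp: B_def)
  have finB: "finite B" using B finite_mbound by (rule finite_subset)
  have "wlen F (wprod w0) \<le> (C + 1) ^ card V"
  proof (rule recursive_bound)
    show "finite V" using finB by (simp add: V_def)
    show "1 \<le> C" by (rule C1)
    show "wlen F (wprod w0) \<in> V" using w0 by (auto simp: V_def B_def)
  next
    fix l assume "l \<in> V"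
    then obtain ws0 where "set ws0 \<subseteq> F" and l: "l = wlen F (wprod ws0)"
      and bd0: "mbound (wprod ws0) b" "\<bar>det (wprod ws0)\<bar> \<le> D"
      by (auto simp: V_def B_def)
    then obtain ws where ws: "length ws = l" "set ws \<subseteq> F" "wprod ws = wprod ws0"
      using wlen_word by metis
    show "l = 0 \<or> (\<exists>m < l. (m = 0 \<or> m \<in> V) \<and> l \<le> 1 + C * m)"
    proof (cases ws)
      case Nil
      then show ?thesis using ws by simp
    next
      case (Cons s ws')
      have s: "mbound s r" "det s \<noteq> 0" "s \<in> F" using F ws(2) Cons by auto
      have X: "s ** wprod ws' = wprod ws0" using Cons ws(3) by simp
      have bd': "mbound (wprod ws') (2 * r * b)"
        by (rule mbound_left_cancel[OF X s(2,1) bd0(1)])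
      have det': "\<bar>det (wprod ws')\<bar> \<le> D"
        using abs_det_le_mult(2)[OF s(2), of "wprod ws'"] bd0(2) X by simp
      have F': "\<forall>s \<in> set ws'. mbound s r \<and> det s \<noteq> 0" using F ws(2) Cons by auto
      obtain wss where wss: "ws' = concat wss" "length wss \<le> msize (wprod ws')"
        "\<forall>us \<in> set wss. mbound (wprod us) b"
        using chop[OF assms(1-3) det' F'] unfolding chopped_def b by blast
      have len: "length wss \<le> C"
        using wss(2) bd' unfolding msize_def mbound_def C_def by linarith
      \<comment> \<open>Removing the first letter makes every piece strictly shorter than
        \<open>l\<close>, and its product lies in \<open>B\<close> again.\<close>
      have seg: "set us \<subseteq> F \<and> wlen F (wprod us) < l \<and> wlen F (wprod us) \<in> V"
        if us: "us \<in> set wss" for us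
      proof -
        obtain xss yss where "wss = xss @ us # yss" using us by (meson split_list)
        then have eq: "ws' = concat xss @ us @ concat yss" using wss(1) by simp
        have usF: "set us \<subseteq> F" using eq Cons ws(2) by auto
        have "det (wprod (concat xss)) \<noteq> 0" "det (wprod (concat yss)) \<noteq> 0"
          using F' eq by (auto intro!: det_wprod_ne_0)
        then have "\<bar>det (wprod us)\<bar> \<le> D"
          using det' abs_det_le_mult(1)[of "wprod (concat yss)" "wprod us"]
            abs_det_le_mult(2)[of "wprod (concat xss)" "wprod us ** wprod (concat yss)"]
          unfolding eq wprod_append by linarith
        then have "wprod us \<in> B" using wss(3) us usF by (auto simp: B_def)
        moreover have "length us < l" using eq Cons ws(1) by auto
        ultimately show ?thesis using usF wlen_le[OF usF] by (auto simp: V_def)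
      qed
      \<comment> \<open>The inserted 0 keeps \<open>Max\<close> defined when there are no pieces;
        hence the alternative \<open>m = 0\<close> in \<open>recursive_bound\<close>.\<close>
      define m where "m = Max (insert 0 ((\<lambda>us. wlen F (wprod us)) ` set wss))"
      have m: "m = 0 \<or> m \<in> (\<lambda>us. wlen F (wprod us)) ` set wss"
        using Max_in[of "insert 0 ((\<lambda>us. wlen F (wprod us)) ` set wss)"] by (auto simp: m_def)
      have "\<exists>vs. set vs \<subseteq> F \<and> wprod vs = wprod (concat wss) \<and> length vs \<le> length wss * m"
        by (rule wlen_concat_le) (use seg in \<open>auto simp: m_def intro!: Max_ge\<close>)
      then obtain vs where vs: "set vs \<subseteq> F" "wprod vs = wprod ws'" "length vs \<le> length wss * m"
        using wss(1) by auto
      have "l \<le> length (s # vs)"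
        unfolding l using wlen_le[of "s # vs" F] vs s(3) X by simp
      moreover have "length wss * m \<le> C * m" using len by (rule mult_right_mono) simp
      ultimately have "l \<le> 1 + C * m" using vs(3) unfolding list.size by linarith
      moreover have "m < l" "m = 0 \<or> m \<in> V" using m seg Cons ws(1) by auto
      ultimately show ?thesis by blast
    qed
  qed
  also have "card V \<le> nat (2 * b + 1) ^ 4"
    unfolding V_def
    using card_image_le[OF finB, of "wlen F"] card_mono[OF finite_mbound B] card_mbound[of b] by linarith
  then have "(C + 1) ^ card V \<le> (C + 1) ^ (nat (2 * b + 1) ^ 4)"
    by (intro power_increasing) auto
  finally show ?thesis by (simp add: C_def)
qed

section \<open>Functions computed by recursive terms\<close>

text \<open>Functions take the whole argument list, so that closure rules can be applied along the
  syntax of a body by \<open>intro\<close>.\<close>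

definition computable :: "nat \<Rightarrow> (nat list \<Rightarrow> nat) \<Rightarrow> bool" where
  "computable n f \<longleftrightarrow> (\<exists>p. \<forall>xs. length xs = n \<longrightarrow> computes p xs (f xs))"

lemma computable_cong:
  assumes "computable n f" "\<And>xs. length xs = n \<Longrightarrow> f xs = g xs"
  shows "computable n g"
  using assms unfolding computable_def by auto

lemma computable_nth: "i < n \<Longrightarrow> computable n (\<lambda>xs. xs ! i)"
  unfolding computable_def by (auto intro!: exI[of _ "Proj i"] computes.proj)

lemma computable_compose:
  assumes "computable (length gs) f" "\<forall>g \<in> set gs. computable n g"
  shows "computable n (\<lambda>xs. f (map (\<lambda>g. g xs) gs))"
proof -
  obtain p where p: "\<And>xs. length xs = length gs \<Longrightarrow> computes p xs (f xs)"
    using assms(1) by (auto simp: computable_def)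
  obtain q where q: "\<And>g xs. g \<in> set gs \<Longrightarrow> length xs = n \<Longrightarrow> computes (q g) xs (g xs)"
    using assms(2) unfolding computable_def by metis
  have "computes (Comp p (map q gs)) xs (f (map (\<lambda>g. g xs) gs))" if "length xs = n" for xs
    by (rule computes.comp[where ys = "map (\<lambda>g. g xs) gs"])
      (use that in \<open>auto simp: list_all2_conv_all_nth p q\<close>)
  then show ?thesis unfolding computable_def by blast
qed

lemma computable_Suc: "computable n f \<Longrightarrow> computable n (\<lambda>xs. Suc (f xs))"
proof -
  assume f: "computable n f"
  have "computable 1 (\<lambda>xs. Suc (xs ! 0))"
    unfolding computable_def
    by (intro exI[of _ Succ]) (auto simp: length_Suc_conv intro: computes.succ)
  with computable_compose[of "[f]" "\<lambda>xs. Suc (xs ! 0)" n] f show ?thesis by simp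
qed

lemma computable_const: "computable n (\<lambda>xs. c)"
proof (induction c)
  case 0
  show ?case unfolding computable_def by (intro exI[of _ Zero]) (auto intro: computes.zero)
qed (rule computable_Suc)

lemma computable_app1:
  "computable 1 (\<lambda>xs. F (xs ! 0)) \<Longrightarrow> computable n f \<Longrightarrow> computable n (\<lambda>xs. F (f xs))"
  using computable_compose[of "[f]" "\<lambda>xs. F (xs ! 0)" n] by simp

lemma computable_app2:
  "computable 2 (\<lambda>xs. F (xs ! 0) (xs ! 1)) \<Longrightarrow> computable n f \<Longrightarrow> computable n g \<Longrightarrow>
    computable n (\<lambda>xs. F (f xs) (g xs))"
  using computable_compose[of "[f, g]" "\<lambda>xs. F (xs ! 0) (xs ! 1)" n] by (simp add: numeral_2_eq_2)

text \<open>Weakening: makes the ambient arguments available below the extra leading arguments of a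
  recursion.\<close>

lemma computable_drop: "computable n f \<Longrightarrow> computable (n + k) (\<lambda>zs. f (drop k zs))"
proof -
  assume f: "computable n f"
  let ?gs = "map (\<lambda>i zs. zs ! (k + i)) [0..<n]"
  have "computable (n + k) (\<lambda>zs. f (map (\<lambda>g. g zs) ?gs))"
    using f by (intro computable_compose) (auto intro: computable_nth)
  then show ?thesis
    by (rule computable_cong) (auto intro!: arg_cong[of _ _ f] nth_equalityI)
qed

lemma computable_nth_drop: "k + i < n \<Longrightarrow> computable n (\<lambda>xs. drop k xs ! i)"
  by (rule computable_cong[OF computable_nth[of "k + i"]]) auto

text \<open>
  The step function sees the recursion index and the previous value in front of the ambient
  arguments, which it reaches through \<open>drop 2\<close>.
\<close>

lemma computable_rec:
  assumes "computable n f" "computable (n + 2) (\<lambda>zs. G (zs ! 0) (zs ! 1) (drop 2 zs))" "computable n N"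
  shows "computable n (\<lambda>xs. rec_nat (f xs) (\<lambda>m y. G m y xs) (N xs))"
proof -
  obtain p where p: "\<And>xs. length xs = n \<Longrightarrow> computes p xs (f xs)"
    using assms(1) by (auto simp: computable_def)
  obtain q where q: "\<And>zs. length zs = n + 2 \<Longrightarrow> computes q zs (G (zs ! 0) (zs ! 1) (drop 2 zs))"
    using assms(2) by (auto simp: computable_def)
  have rec: "computes (PrimRec p q) (m # xs) (rec_nat (f xs) (\<lambda>m y. G m y xs) m)" if "length xs = n" for m xs
  proof (induction m)
    case 0
    show ?case using p[OF that] by (auto intro: computes.rec_0)
  next
    case (Suc m)
    from computes.rec_Suc[OF this q] show ?case using that by simp
  qed
  have "computable (Suc n) (\<lambda>zs. rec_nat (f (drop 1 zs)) (\<lambda>m y. G m y (drop 1 zs)) (zs ! 0))"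
    unfolding computable_def using rec by (intro exI[of _ "PrimRec p q"]) (auto simp: length_Suc_conv)
  \<comment> \<open>\<open>PrimRec\<close> recurses on its first argument, so \<open>N\<close> is
    put in front of projections that reproduce the ambient arguments.\<close>
  then have "computable (length (N # map (\<lambda>i zs. zs ! i) [0..<n]))
      (\<lambda>zs. rec_nat (f (drop 1 zs)) (\<lambda>m y. G m y (drop 1 zs)) (zs ! 0))" by simp
  moreover have "\<forall>g \<in> set (N # map (\<lambda>i zs. zs ! i) [0..<n]). computable n g"
    using assms(3) by (auto intro: computable_nth)
  ultimately have "computable n (\<lambda>xs. (\<lambda>zs. rec_nat (f (drop 1 zs)) (\<lambda>m y. G m y (drop 1 zs)) (zs ! 0))
      (map (\<lambda>g. g xs) (N # map (\<lambda>i zs. zs ! i) [0..<n])))"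
    by (rule computable_compose)
  then have "computable n (\<lambda>xs. rec_nat (f (map (\<lambda>i. xs ! i) [0..<n]))
      (\<lambda>m y. G m y (map (\<lambda>i. xs ! i) [0..<n])) (N xs))"
    by (simp add: comp_def)
  then show ?thesis by (rule computable_cong) (metis map_nth)
qed

section \<open>Primitive recursive arithmetic, case distinctions and bounded sums\<close>

lemma computable_add:
  assumes "computable n f" "computable n g"
  shows "computable n (\<lambda>xs. f xs + g xs)"
proof -
  have "computable n (\<lambda>xs. rec_nat (g xs) (\<lambda>_ y. Suc y) (f xs))"
    by (intro computable_rec computable_Suc computable_nth assms) simp
  moreover have "rec_nat b (\<lambda>_ y. Suc y) a = a + b" for a b by (induction a) auto
  ultimately show ?thesis by simp
qed

lemma computable_mult:
  assumes "computable n f" "computable n g"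
  shows "computable n (\<lambda>xs. f xs * g xs)"
proof -
  have "computable n (\<lambda>xs. rec_nat 0 (\<lambda>_ y. y + g xs) (f xs))"
    by (intro computable_rec computable_add computable_const computable_nth computable_drop assms) simp
  moreover have "rec_nat 0 (\<lambda>_ y. y + b) a = a * b" for a b by (induction a) auto
  ultimately show ?thesis by simp
qed

lemma computable_power:
  assumes "computable n f" "computable n g"
  shows "computable n (\<lambda>xs. f xs ^ g xs)"
proof -
  have "computable n (\<lambda>xs. rec_nat 1 (\<lambda>_ y. y * f xs) (g xs))"
    by (intro computable_rec computable_mult computable_const computable_nth computable_drop assms) simp
  moreover have "rec_nat 1 (\<lambda>_ y. y * b) a = b ^ a" for a b :: nat by (induction a) auto
  ultimately show ?thesis by simp
qed

lemma computable_diff: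
  assumes "computable n f" "computable n g"
  shows "computable n (\<lambda>xs. f xs - g xs)"
proof -
  have "computable 1 (\<lambda>xs. rec_nat 0 (\<lambda>m _. m) (xs ! 0))"
    by (intro computable_rec computable_const computable_nth) simp_all
  moreover have "rec_nat 0 (\<lambda>m _. m) a = a - 1" for a by (cases a) auto
  ultimately have "computable 1 (\<lambda>xs. xs ! 0 - 1)" by simp
  from computable_app1[where F = "\<lambda>y. y - 1", OF this computable_nth[of 1 "n + 2"]]
  have "computable n (\<lambda>xs. rec_nat (f xs) (\<lambda>_ y. y - 1) (g xs))"
    by (intro computable_rec assms) simp
  moreover have "rec_nat b (\<lambda>_ y. y - 1) a = b - a" for a b :: nat by (induction a) auto
  ultimately show ?thesis by simp
qed

lemma computable_if_eq:
  assumes "computable n f" "computable n g" "computable n u" "computable n v"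
  shows "computable n (\<lambda>xs. if f xs = g xs then u xs else v xs)"
proof -
  \<comment> \<open>\<open>?d\<close> is the distance. As subtraction is truncated,
    \<open>1 - ?d\<close> is 1 on equality and 0 otherwise.\<close>
  let ?d = "\<lambda>a b :: nat. (a - b) + (b - a)"
  have "computable n (\<lambda>xs. u xs * (1 - ?d (f xs) (g xs)) + v xs * (1 - (1 - ?d (f xs) (g xs))))"
    by (intro computable_add computable_mult computable_diff computable_const assms)
  then show ?thesis by (rule computable_cong) auto
qed

lemma computable_if_le:
  assumes "computable n f" "computable n g" "computable n u" "computable n v"
  shows "computable n (\<lambda>xs. if f xs \<le> g xs then u xs else v xs)"
proof -
  have "computable n (\<lambda>xs. if f xs - g xs = 0 then u xs else v xs)"
    by (intro computable_if_eq computable_diff computable_const assms)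
  then show ?thesis by simp
qed

lemma computable_sum:
  assumes "computable n N" "computable (n + 1) (\<lambda>zs. G (zs ! 0) (drop 1 zs))"
  shows "computable n (\<lambda>xs. \<Sum>i < N xs. G i xs)"
proof -
  \<comment> \<open>Position 1 holds the previous value of the recursion, which \<open>G\<close>
    does not see; \<open>?gs\<close> skips it.\<close>
  let ?gs = "(\<lambda>zs. zs ! 0) # map (\<lambda>i zs. zs ! (2 + i)) [0..<n]"
  have "computable (n + 2) (\<lambda>zs. (\<lambda>zs. G (zs ! 0) (drop 1 zs)) (map (\<lambda>g. g zs) ?gs))"
    using assms(2) by (intro computable_compose) (auto intro: computable_nth)
  then have "computable (n + 2) (\<lambda>zs. G (zs ! 0) (drop 2 zs))"
    by (rule computable_cong) (auto intro!: arg_cong[of _ _ "G _"] nth_equalityI)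
  then have "computable n (\<lambda>xs. rec_nat 0 (\<lambda>m y. y + G m xs) (N xs))"
    by (intro computable_rec computable_add computable_const computable_nth assms(1)) simp_all
  moreover have "rec_nat 0 (\<lambda>m y. y + G m xs) k = (\<Sum>i < k. G i xs)" for k xs
    by (induction k) auto
  ultimately show ?thesis by simp
qed

lemmas computable_arith = computable_const computable_nth computable_nth_drop computable_Suc
  computable_add computable_mult computable_diff computable_power computable_if_eq computable_if_le

section \<open>Pairing and division by two\<close>

lemma computable_triangle: "computable n f \<Longrightarrow> computable n (\<lambda>xs. triangle (f xs))"
proof (rule computable_app1[where F = triangle])
  have "computable 1 (\<lambda>xs. \<Sum>i < Suc (xs ! 0). i)"
    by (intro computable_sum computable_arith) simp_all
  moreover have "(\<Sum>i < Suc k. i) = triangle k" for k by (induction k) auto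
  ultimately show "computable 1 (\<lambda>xs. triangle (xs ! 0))" by simp
qed

lemma computable_prod_encode:
  "computable n f \<Longrightarrow> computable n g \<Longrightarrow> computable n (\<lambda>xs. prod_encode (f xs, g xs))"
  unfolding prod_encode_def prod.case by (intro computable_triangle computable_add)

text \<open>Expresses the decoding of pairs by bounded sums, which are primitive recursive.\<close>

lemma sum_prod_encode_eq:
  fixes h :: "nat \<Rightarrow> nat \<Rightarrow> nat"
  shows "(\<Sum>a < Suc z. \<Sum>b < Suc z. if prod_encode (a, b) = z then h a b else 0) =
    h (fst (prod_decode z)) (snd (prod_decode z))"
proof -
  obtain a0 b0 where z: "prod_decode z = (a0, b0)" by fastforce
  then have z': "z = prod_encode (a0, b0)" by (metis prod_decode_inverse)
  \<comment> \<open>Components of a pair are at most its code, so the range of the sums contains the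
    one pair that is selected.\<close>
  have "a0 < Suc z" "b0 < Suc z"
    using le_prod_encode_1[of a0 b0] le_prod_encode_2[of b0 a0] z' by simp_all
  moreover have "(if prod_encode (a, b) = z then h a b else 0) =
    (if a = a0 then if b = b0 then h a0 b0 else 0 else 0)" for a b
    using z' by (auto simp: prod_encode_eq)
  moreover have "(\<Sum>b < Suc z. if a = a0 then if b = b0 then h a0 b0 else 0 else 0) =
    (if a = a0 then \<Sum>b < Suc z. if b = b0 then h a0 b0 else 0 else 0)" for a by simp
  ultimately show ?thesis by (simp add: z del: sum.lessThan_Suc)
qed

lemma computable_fst_prod_decode: "computable n f \<Longrightarrow> computable n (\<lambda>xs. fst (prod_decode (f xs)))"
  and computable_snd_prod_decode: "computable n f \<Longrightarrow> computable n (\<lambda>xs. snd (prod_decode (f xs)))"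
proof -
  have "computable 1 (\<lambda>xs. \<Sum>a < Suc (xs ! 0). \<Sum>b < Suc (xs ! 0).
      if prod_encode (a, b) = xs ! 0 then a else 0)"
    by (intro computable_sum computable_arith computable_prod_encode) (simp_all add: computable_nth_drop)
  then show "computable n f \<Longrightarrow> computable n (\<lambda>xs. fst (prod_decode (f xs)))"
    unfolding sum_prod_encode_eq by (rule computable_app1[where F = "\<lambda>z. fst (prod_decode z)"])
  have "computable 1 (\<lambda>xs. \<Sum>a < Suc (xs ! 0). \<Sum>b < Suc (xs ! 0).
      if prod_encode (a, b) = xs ! 0 then b else 0)"
    by (intro computable_sum computable_arith computable_prod_encode) (simp_all add: computable_nth_drop)
  then show "computable n f \<Longrightarrow> computable n (\<lambda>xs. snd (prod_decode (f xs)))"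
    unfolding sum_prod_encode_eq by (rule computable_app1[where F = "\<lambda>z. snd (prod_decode z)"])
qed

lemma computable_mod_2: "computable n f \<Longrightarrow> computable n (\<lambda>xs. f xs mod 2)"
proof (rule computable_app1[where F = "\<lambda>y. y mod 2"])
  have "computable 1 (\<lambda>xs. rec_nat 0 (\<lambda>_ y. 1 - y) (xs ! 0))"
    by (intro computable_rec computable_arith) simp_all
  moreover have "rec_nat 0 (\<lambda>_ y. 1 - y) k = k mod 2" for k :: nat by (induction k) (auto simp: mod_Suc)
  ultimately show "computable 1 (\<lambda>xs. xs ! 0 mod 2)" by simp
qed

lemma computable_div_2: "computable n f \<Longrightarrow> computable n (\<lambda>xs. f xs div 2)"
proof (rule computable_app1[where F = "\<lambda>y. y div 2"])
  \<comment> \<open>\<open>k div 2\<close> is the number of odd numbers below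
    \<open>k\<close>.\<close>
  have "computable 1 (\<lambda>xs. rec_nat 0 (\<lambda>m y. y + m mod 2) (xs ! 0))"
    by (intro computable_rec computable_arith computable_mod_2) simp_all
  moreover have "rec_nat 0 (\<lambda>m y. y + m mod 2) k = k div 2" for k :: nat
    by (induction k) (auto simp: div_Suc mod_Suc)
  ultimately show "computable 1 (\<lambda>xs. xs ! 0 div 2)" by simp
qed

section \<open>Arithmetic on codes\<close>

text \<open>Integer codes are even for nonnegative and odd for negative numbers. Writing an integer
  as a difference of two naturals allows its arithmetic to be done on naturals.\<close>

definition code_pos_part :: "nat \<Rightarrow> nat" where
  "code_pos_part x = (if x mod 2 = 0 then x div 2 else 0)"

definition code_neg_part :: "nat \<Rightarrow> nat" where
  "code_neg_part x = (if x mod 2 = 0 then 0 else Suc (x div 2))"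

lemma int_decode_eq_parts: "int_decode x = int (code_pos_part x) - int (code_neg_part x)"
  by (auto simp: int_decode_def sum_decode_def code_pos_part_def code_neg_part_def even_iff_mod_2_eq_zero)

lemma int_encode_diff: "int_encode (int p - int q) = (if q \<le> p then 2 * (p - q) else 2 * (q - p) - 1)"
  by (auto simp: int_encode_def sum_encode_def)

definition code_dot :: "nat \<Rightarrow> nat \<Rightarrow> nat \<Rightarrow> nat \<Rightarrow> nat" where
  "code_dot a b c d = int_encode (int_decode a * int_decode b + int_decode c * int_decode d)"

lemma computable_code_dot:
  assumes "computable n f" "computable n g" "computable n h" "computable n k"
  shows "computable n (\<lambda>xs. code_dot (f xs) (g xs) (h xs) (k xs))"
proof -
  let ?P = code_pos_part and ?N = code_neg_part
  \<comment> \<open>The expanded products are sorted by sign: \<open>?p\<close> collects the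
    positive terms and \<open>?q\<close> the negative ones.\<close>
  let ?p = "\<lambda>a b c d. ?P a * ?P b + ?N a * ?N b + (?P c * ?P d + ?N c * ?N d)"
  let ?q = "\<lambda>a b c d. ?P a * ?N b + ?N a * ?P b + (?P c * ?N d + ?N c * ?P d)"
  let ?e = "\<lambda>p q :: nat. if q \<le> p then 2 * (p - q) else 2 * (q - p) - 1"
  have "code_dot a b c d = int_encode (int (?p a b c d) - int (?q a b c d))" for a b c d
    unfolding code_dot_def int_decode_eq_parts by (simp add: algebra_simps)
  then have eq: "code_dot a b c d = ?e (?p a b c d) (?q a b c d)" for a b c d
    by (simp only: int_encode_diff)
  have pos: "computable n (\<lambda>xs. ?P (f xs))" and neg: "computable n (\<lambda>xs. ?N (f xs))"
    if "computable n f" for n f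
    unfolding code_pos_part_def code_neg_part_def
    using that by (intro computable_arith computable_div_2 computable_mod_2; assumption)+
  have e: "computable 2 (\<lambda>xs. ?e (xs ! 0) (xs ! 1))"
    by (intro computable_arith) simp_all
  show ?thesis unfolding eq
    by (rule computable_app2[where F = ?e, OF e]) (intro computable_add computable_mult pos neg assms)+
qed

section \<open>Coded lists, matrices and words\<close>

definition code_hd :: "nat \<Rightarrow> nat" where "code_hd x = fst (prod_decode (x - 1))"

definition code_tl :: "nat \<Rightarrow> nat" where "code_tl x = snd (prod_decode (x - 1))"

definition code_Cons :: "nat \<Rightarrow> nat \<Rightarrow> nat" where "code_Cons a x = Suc (prod_encode (a, x))"

text \<open>Makes the tail of the code 0 again 0, in agreement with
  \<open>tl [] = []\<close>.\<close>

lemma prod_decode_0: "prod_decode 0 = (0, 0)"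
  unfolding prod_decode_def by (subst prod_decode_aux.simps) simp

lemma code_hd_encode [simp]: "code_hd (list_encode (a # l)) = a"
  and code_tl_encode [simp]: "code_tl (list_encode l) = list_encode (tl l)"
  and code_Cons_encode [simp]: "code_Cons a (list_encode l) = list_encode (a # l)"
  by (cases l; simp add: code_hd_def code_tl_def code_Cons_def prod_decode_0)+

lemma computable_code_hd: "computable n f \<Longrightarrow> computable n (\<lambda>xs. code_hd (f xs))"
  and computable_code_tl: "computable n f \<Longrightarrow> computable n (\<lambda>xs. code_tl (f xs))"
  and computable_code_Cons: "computable n f \<Longrightarrow> computable n g \<Longrightarrow> computable n (\<lambda>xs. code_Cons (f xs) (g xs))"
  unfolding code_hd_def code_tl_def code_Cons_def
  by (intro computable_arith computable_fst_prod_decode computable_snd_prod_decode computable_prod_encode;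
      assumption)+

definition code_mult :: "nat \<Rightarrow> nat \<Rightarrow> nat" where
  "code_mult x y =
    (let x1 = code_hd x; x2 = code_hd (code_tl x);
         x3 = code_hd (code_tl (code_tl x)); x4 = code_hd (code_tl (code_tl (code_tl x)));
         y1 = code_hd y; y2 = code_hd (code_tl y);
         y3 = code_hd (code_tl (code_tl y)); y4 = code_hd (code_tl (code_tl (code_tl y)))
     in code_Cons (code_dot x1 y1 x2 y3) (code_Cons (code_dot x1 y2 x2 y4)
         (code_Cons (code_dot x3 y1 x4 y3) (code_Cons (code_dot x3 y2 x4 y4) 0))))"

lemma computable_code_mult:
  assumes "computable n f" "computable n g"
  shows "computable n (\<lambda>xs. code_mult (f xs) (g xs))"
  unfolding code_mult_def Let_def
  by (intro computable_code_Cons computable_code_dot computable_code_hd computable_code_tl computable_const assms)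

lemma code_mult_matrix_code: "code_mult (matrix_code A) (matrix_code B) = matrix_code (A ** B)"
proof -
  have "code_Cons a 0 = list_encode [a]" for a using code_Cons_encode[of a "[]"] by simp
  then show ?thesis
    unfolding matrix_code_def code_mult_def Let_def
    by (simp add: code_dot_def matrix_matrix_mult_def sum_2 del: list_encode.simps)
qed

definition code_drop :: "nat \<Rightarrow> nat \<Rightarrow> nat" where
  "code_drop i x = rec_nat x (\<lambda>_. code_tl) i"

lemma code_drop_encode: "code_drop i (list_encode l) = list_encode (drop i l)"
  by (induction i) (simp_all add: code_drop_def drop_Suc tl_drop)

lemma computable_code_drop:
  assumes "computable n f" "computable n g"
  shows "computable n (\<lambda>xs. code_drop (f xs) (g xs))"
  unfolding code_drop_def
  by (intro computable_rec computable_code_tl computable_nth assms) simp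

text \<open>
  Dropping too many elements yields \<open>0\<close>, the code of the empty list; an index \<open>j\<close> out of range
  therefore acts as the identity matrix.
\<close>

definition code_step :: "nat \<Rightarrow> nat \<Rightarrow> nat \<Rightarrow> nat" where
  "code_step x j y = (if code_drop j x = 0 then y else code_mult y (code_hd (code_drop j x)))"

lemma computable_code_step:
  assumes "computable n f" "computable n g" "computable n h"
  shows "computable n (\<lambda>xs. code_step (f xs) (g xs) (h xs))"
  unfolding code_step_def
  by (intro computable_if_eq computable_code_mult computable_code_hd computable_code_drop computable_const assms)

text \<open>A word is a coded list \<open>w\<close> of indices into the generators. Past its end the
  index read is 0, which denotes the first generator, so the number \<open>n\<close> of letters is
  given separately.\<close>

definition code_run :: "nat \<Rightarrow> nat \<Rightarrow> nat \<Rightarrow> nat" where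
  "code_run x w n = rec_nat (matrix_code (mat 1)) (\<lambda>i y. code_step x (code_hd (code_drop i w)) y) n"

lemma computable_code_run:
  assumes "computable n f" "computable n g" "computable n h"
  shows "computable n (\<lambda>xs. code_run (f xs) (g xs) (h xs))"
  unfolding code_run_def
  by (intro computable_rec computable_code_step computable_code_hd computable_code_drop computable_const
      computable_drop computable_nth assms) simp_all

text \<open>The code of \<open>n\<close> copies of \<open>c\<close>, which bounds the search over
  index lists.\<close>

definition max_code :: "nat \<Rightarrow> nat \<Rightarrow> nat" where
  "max_code c n = rec_nat 0 (\<lambda>_ y. code_Cons c y) n"

lemma computable_max_code:
  assumes "computable n f" "computable n g"
  shows "computable n (\<lambda>xs. max_code (f xs) (g xs))"
  unfolding max_code_def
  by (intro computable_rec computable_code_Cons computable_const computable_drop computable_nth assms) simp_all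

lemma triangle_mono: "m \<le> n \<Longrightarrow> triangle m \<le> triangle n"
  by (induction n) (auto simp: le_Suc_eq)

text \<open>\<open>prod_encode\<close> is monotone in both arguments, and lengthening a list by a
  further element does not decrease the bound.\<close>

lemma list_encode_le_max_code:
  "\<forall>j \<in> set js. j \<le> c \<Longrightarrow> length js \<le> n \<Longrightarrow> list_encode js \<le> max_code c n"
proof (induction js arbitrary: n)
  case (Cons j js)
  then obtain m where n: "n = Suc m" "length js \<le> m" by (cases n) auto
  then have "list_encode js \<le> max_code c m" "j \<le> c" using Cons by auto
  then have "prod_encode (j, list_encode js) \<le> prod_encode (c, max_code c m)"
    by (auto simp: prod_encode_def intro!: add_mono triangle_mono)
  then show ?case by (simp add: n max_code_def code_Cons_def)
qed simp

lemma mem_le_list_encode: "a \<in> set l \<Longrightarrow> a \<le> list_encode l"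
proof (induction l)
  case (Cons b l)
  then show ?case
    using le_prod_encode_1[of b "list_encode l"] le_prod_encode_2[of "list_encode l" b] by auto
qed simp

lemma length_le_list_encode: "length l \<le> list_encode l"
proof (induction l)
  case (Cons b l)
  then show ?case using le_prod_encode_2[of "list_encode l" b] by auto
qed simp

lemma abs_le_int_encode: "\<bar>i\<bar> \<le> int (int_encode i)"
  by (auto simp: int_encode_def sum_encode_def)

section \<open>Bounded search for a word\<close>

lemma matrices_code_eq_0_iff: "matrices_code As = 0 \<longleftrightarrow> As = []"
  by (cases As) (simp_all add: matrices_code_def)

lemma code_drop_matrices: "code_drop i (matrices_code As) = matrices_code (drop i As)"
  by (simp add: matrices_code_def code_drop_encode drop_map)

lemma code_step_matrices:
  "code_step (matrices_code As) j (matrix_code A) = matrix_code (if j < length As then A ** As ! j else A)"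
proof (cases "j < length As")
  case True
  then have "drop j As = As ! j # drop (Suc j) As" by (rule Cons_nth_drop_Suc[symmetric])
  moreover have "code_hd (matrices_code (B # Bs)) = matrix_code B" for B Bs
    by (simp add: matrices_code_def del: list_encode.simps)
  ultimately show ?thesis
    using True by (simp add: code_step_def code_drop_matrices matrices_code_eq_0_iff code_mult_matrix_code)
next
  case False
  then show ?thesis by (simp add: code_step_def code_drop_matrices matrices_code_eq_0_iff)
qed

text \<open>Out-of-range indices are skipped, so any \<open>w\<close> and \<open>n\<close> yield a
  genuine word, possibly with fewer than \<open>n\<close> letters.\<close>

lemma code_run_sound:
  "\<exists>ws. set ws \<subseteq> set As \<and> code_run (matrices_code As) w n = matrix_code (wprod ws)"
proof (induction n)
  case 0
  show ?case by (intro exI[of _ "[]"]) (simp add: code_run_def)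
next
  case (Suc n)
  then obtain ws where ws: "set ws \<subseteq> set As" "code_run (matrices_code As) w n = matrix_code (wprod ws)"
    by blast
  let ?j = "code_hd (code_drop n w)"
  have run: "code_run (matrices_code As) w (Suc n) =
      matrix_code (if ?j < length As then wprod ws ** As ! ?j else wprod ws)"
    using ws(2) by (simp add: code_run_def code_step_matrices)
  show ?case
  proof (cases "?j < length As")
    case True
    then show ?thesis
      using ws(1) run
      by (intro exI[of _ "ws @ [As ! ?j]"]) (simp add: wprod_append del: foldr_append)
  next
    case False
    then show ?thesis using ws(1) run by (intro exI[of _ ws]) simp
  qed
qed

lemma code_run_complete:
  assumes "\<forall>j \<in> set js. j < length As" "n \<le> length js"
  shows "code_run (matrices_code As) (list_encode js) n =
    matrix_code (wprod (map (\<lambda>j. As ! j) (take n js)))"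
  using assms(2)
proof (induction n)
  case 0
  show ?case by (simp add: code_run_def)
next
  case (Suc n)
  then have "drop n js = js ! n # drop (Suc n) js" by (simp add: Cons_nth_drop_Suc)
  then have "code_hd (code_drop n (list_encode js)) = js ! n"
    by (simp add: code_drop_encode del: list_encode.simps)
  moreover have "js ! n < length As" using assms(1) Suc.prems by simp
  ultimately show ?case
    using Suc by (simp add: code_run_def code_step_matrices take_Suc_conv_app_nth wprod_append
        del: foldr_append)
qed

text \<open>The constants of \<open>wlen_bound\<close> read off from the input: codes bound the
  entries they encode, so \<open>r \<ge> 1\<close> bounds the generators and the target, whose
  determinant is then at most \<open>2 * r * r\<close>.\<close>

definition code_length_bound :: "nat \<Rightarrow> nat \<Rightarrow> nat" where
  "code_length_bound x y =
    (let r = Suc (x + y); D = 2 * r * r; k = 2 * D * r; b = 4 * k * k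
     in (8 * r * b + 1) ^ ((2 * b + 1) ^ 4))"

lemma computable_code_length_bound:
  assumes "computable n f" "computable n g"
  shows "computable n (\<lambda>xs. code_length_bound (f xs) (g xs))"
  unfolding code_length_bound_def Let_def
  by (intro computable_power computable_mult computable_add computable_Suc computable_const assms)

lemma mbound_matrix_code: "mbound A (int (matrix_code A))"
proof -
  have "\<bar>i\<bar> \<le> int (matrix_code A)"
    if "i \<in> {A $ 1 $ 1, A $ 1 $ 2, A $ 2 $ 1, A $ 2 $ 2}" for i
  proof -
    have "int_encode i \<le> matrix_code A"
      unfolding matrix_code_def by (rule mem_le_list_encode) (use that in auto)
    then show ?thesis using abs_le_int_encode[of i] by linarith
  qed
  then show ?thesis by (simp add: mbound_def)
qed

lemma wlen_le_code_length_bound: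
  assumes "\<forall>A \<in> set Fs. det A \<noteq> 0" "set ws \<subseteq> set Fs"
  shows "wlen (set Fs) (wprod ws) \<le> code_length_bound (matrices_code Fs) (matrix_code (wprod ws))"
proof -
  define N where "N = Suc (matrices_code Fs + matrix_code (wprod ws))"
  define r where "r = int N"
  define D where "D = 2 * r * r"
  define k where "k = 2 * D * r"
  define b where "b = 4 * k * k"
  have r: "1 \<le> r" by (simp add: r_def N_def)
  have "1 * 1 \<le> r * r" using r by (intro mult_mono) auto
  then have D: "1 \<le> D" by (simp add: D_def)
  have "1 * 1 \<le> D * D" using D by (intro mult_mono) auto
  then have "1 * 1 \<le> (D * D) * r" using r by (intro mult_mono) auto
  then have "1 * r \<le> ((D * D) * r) * r" using r by (intro mult_right_mono) auto
  \<comment> \<open>Places the target, bounded by \<open>r\<close>, in the ball of radius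
    \<open>b\<close>.\<close>
  then have rb: "r \<le> b" using r by (simp add: b_def k_def algebra_simps)
  have F: "\<forall>s \<in> set Fs. mbound s r \<and> det s \<noteq> 0"
  proof
    fix s assume s: "s \<in> set Fs"
    have "matrix_code s \<le> matrices_code Fs"
      unfolding matrices_code_def by (rule mem_le_list_encode) (use s in auto)
    then show "mbound s r \<and> det s \<noteq> 0"
      using mbound_mono[OF mbound_matrix_code[of s], of r] s assms(1) by (simp add: r_def N_def)
  qed
  have M: "mbound (wprod ws) r"
    using mbound_mono[OF mbound_matrix_code[of "wprod ws"], of r] by (simp add: r_def N_def)
  have "\<bar>det (wprod ws)\<bar> \<le> 2 * r * r"
    unfolding det_2 by (rule abs_dot_le(2)) (use M in \<open>auto simp: mbound_def\<close>)
  then have det: "\<bar>det (wprod ws)\<bar> \<le> D" by (simp add: D_def)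
  \<comment> \<open>\<open>b\<close> as a natural number, to match the computation in
    \<open>code_length_bound\<close>.\<close>
  define b' where "b' = 4 * (2 * (2 * N * N) * N) * (2 * (2 * N * N) * N)"
  have b': "b = int b'" by (simp add: b_def b'_def k_def D_def r_def)
  have "wlen (set Fs) (wprod ws) \<le> (nat (8 * r * b) + 1) ^ (nat (2 * b + 1) ^ 4)"
    by (rule wlen_bound[OF D r k_def b_def F assms(2) mbound_mono[OF M rb] det])
  also have "nat (8 * r * b) = 8 * N * b'" by (simp add: b' r_def nat_mult_distrib)
  also have "nat (2 * b + 1) = 2 * b' + 1" by (simp add: b' nat_add_distrib nat_mult_distrib)
  also have "(8 * N * b' + 1) ^ ((2 * b' + 1) ^ 4) =
      code_length_bound (matrices_code Fs) (matrix_code (wprod ws))"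
    by (simp only: code_length_bound_def Let_def N_def b'_def)
  finally show ?thesis .
qed

text \<open>Bounded existential quantifiers become sums that count hits. The code \<open>x\<close>
  also bounds the number of generators and hence all indices.\<close>

definition code_decide :: "nat \<Rightarrow> nat \<Rightarrow> nat" where
  "code_decide x y =
    (if (\<Sum>n < Suc (code_length_bound x y). \<Sum>w < Suc (max_code x (code_length_bound x y)).
        if code_run x w n = y then 1 else 0 :: nat) = 0 then 0 else 1)"

lemma computable_code_decide: "computable 2 (\<lambda>xs. code_decide (xs ! 0) (xs ! 1))"
  unfolding code_decide_def
  by (intro computable_if_eq computable_sum computable_Suc computable_const computable_max_code
      computable_code_length_bound computable_code_run computable_nth computable_nth_drop)
    (simp_all add: computable_nth_drop)

lemma code_decide_eq:
  "code_decide x y =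
    (if \<exists>n \<le> code_length_bound x y. \<exists>w \<le> max_code x (code_length_bound x y). code_run x w n = y
     then 1 else 0)"
  unfolding code_decide_def by (auto simp: less_Suc_eq_le simp del: sum.lessThan_Suc)

section \<open>Correctness of the search\<close>

lemma mem_generated_semigroup_iff:
  "M \<in> generated_semigroup F \<longleftrightarrow> (\<exists>ws. set ws \<subseteq> F \<and> wprod ws = M)"
proof
  show "\<exists>ws. set ws \<subseteq> F \<and> wprod ws = M" if "M \<in> generated_semigroup F"
    using that unfolding generated_semigroup_def
    by (auto intro: exI[of _ "[]"])
  show "M \<in> generated_semigroup F" if "\<exists>ws. set ws \<subseteq> F \<and> wprod ws = M"
  proof -
    from that obtain ws where "set ws \<subseteq> F" "wprod ws = M" by blast
    then show ?thesis unfolding generated_semigroup_def by (cases "ws = []") auto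
  qed
qed

lemma code_decide_correct:
  assumes "\<forall>A \<in> set Fs. det A \<noteq> 0"
  shows "code_decide (matrices_code Fs) (matrix_code M) =
    (if M \<in> generated_semigroup (set Fs) then 1 else 0)"
proof -
  let ?x = "matrices_code Fs" and ?y = "matrix_code M"
  let ?L = "code_length_bound ?x ?y"
  have "(\<exists>n \<le> ?L. \<exists>w \<le> max_code ?x ?L. code_run ?x w n = ?y) \<longleftrightarrow> M \<in> generated_semigroup (set Fs)"
  proof
    assume "\<exists>n \<le> ?L. \<exists>w \<le> max_code ?x ?L. code_run ?x w n = ?y"
    then obtain n w where run: "code_run ?x w n = ?y" by blast
    obtain ws where "set ws \<subseteq> set Fs" "code_run ?x w n = matrix_code (wprod ws)"
      using code_run_sound by blast
    then have "set ws \<subseteq> set Fs" "wprod ws = M"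
      using run injD[OF inj_matrix_code] by metis+
    then show "M \<in> generated_semigroup (set Fs)" unfolding mem_generated_semigroup_iff by blast
  next
    assume "M \<in> generated_semigroup (set Fs)"
    then obtain ws0 where ws0: "set ws0 \<subseteq> set Fs" "wprod ws0 = M"
      unfolding mem_generated_semigroup_iff by blast
    \<comment> \<open>A shortest word obeys the length bound, so its index list is among those
      searched.\<close>
    obtain ws where ws: "length ws = wlen (set Fs) M" "set ws \<subseteq> set Fs" "wprod ws = M"
      using wlen_word[OF ws0(1)] ws0(2) by metis
    have len: "length ws \<le> ?L"
      using wlen_le_code_length_bound[OF assms ws(2)] ws(1,3) by simp
    have "\<forall>A \<in> set ws. \<exists>j < length Fs. Fs ! j = A"
      using ws(2) by (metis in_set_conv_nth subsetD)
    then obtain idx where idx: "\<And>A. A \<in> set ws \<Longrightarrow> idx A < length Fs \<and> Fs ! idx A = A"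
      by metis
    define js where "js = map idx ws"
    have js: "\<forall>j \<in> set js. j < length Fs" "map (\<lambda>j. Fs ! j) js = ws"
      using idx by (auto simp: js_def intro: map_idI)
    have "length Fs \<le> ?x"
      using length_le_list_encode[of "map matrix_code Fs"] by (simp add: matrices_code_def)
    then have "list_encode js \<le> max_code ?x ?L"
      using js(1) len by (intro list_encode_le_max_code) (auto simp: js_def)
    moreover have "code_run ?x (list_encode js) (length js) = ?y"
      using code_run_complete[OF js(1), of "length js"] js(2) ws(3) by simp
    moreover have "length js \<le> ?L" using len by (simp add: js_def)
    ultimately show "\<exists>n \<le> ?L. \<exists>w \<le> max_code ?x ?L. code_run ?x w n = ?y" by blast
  qed
  then show ?thesis by (simp add: code_decide_eq)
qed

theorem theorem1:
  "\<exists>p. \<forall>(Fs :: (int ^ 2 ^ 2) list) (M :: int ^ 2 ^ 2).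
     (\<forall>A \<in> set Fs. det A \<noteq> 0) \<longrightarrow>
     computes p [matrices_code Fs, matrix_code M]
       (if M \<in> generated_semigroup (set Fs) then 1 else 0)"
proof -
  obtain p where "\<And>xs. length xs = 2 \<Longrightarrow> computes p xs (code_decide (xs ! 0) (xs ! 1))"
    using computable_code_decide by (auto simp: computable_def)
  from this[of "[x, y]" for x y] have "computes p [x, y] (code_decide x y)" for x y
    by simp
  then show ?thesis using code_decide_correct by metis
qed

end
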